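(* Let $f(x)=a_0+a_1x+\cdots+a_tx^t\in\mathbb{Z}[x]$ be a permutational polynomial (i.e. for each $n\ge 1$ the map $\mathbb{Z}/2^n\mathbb{Z}\to\mathbb{Z}/2^n\mathbb{Z}$ induced by $f$ is a permutation), acting on the rooted binary tree $\{0,1\}^*$. Then this action is level transitive if and only if the following three conditions hold: (i) $a_0\equiv 1 \pmod 2$; (ii) $2a_2\equiv a_3+a_5+a_7+\cdots \pmod 4$; (iii) $a_2+a_1-1\equiv a_4+a_6+a_8+\cdots \pmod 4$. Here $a_i=0$ for $i>t$.
   Context: Tree: $\{0,1\}^*$ is the set of all finite binary words, viewed as a rooted binary tree in which each word $v$ is adjacent to $v0$ and $v1$; the $n$-th level is $\{0,1\}^n$. The $n$-th level is identified with $\mathbb{Z}/2^n\mathbb{Z}$ via $x_0x_1\ldots x_{n-1}\mapsto x_0+2x_1+\cdots+2^{n-1}x_{n-1}$. A polynomial $f\in\mathbb{Z}[x]$ acts on the tree by acting on each level $\{0,1\}^n\cong\mathbb{Z}/2^n\mathbb{Z}$ via evaluation modulo $2^n$ (the root is fixed); if $f$ is permutational this is an automorphism of the tree. Level transitive: an automorphism of $\{0,1\}^*$ acts level transitively if the cyclic group it generates acts transitively on each level $\{0,1\}^n$. For $f$ this means that for every $n\ge 1$ the permutation of $\mathbb{Z}/2^n\mathbb{Z}$ induced by $f$ is a single cycle of length $2^n$. *)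

theory Defs
  imports
    "HOL-Algebra.Bij"
    "HOL-Algebra.Generated_Groups"
    "HOL-Computational_Algebra.Polynomial"
    "HOL-Number_Theory.Cong"
begin

text \<open>
  Finite binary words are Boolean lists (\<open>False\<close> is the letter 0, \<open>True\<close> the letter 1).  The
  children of a word \<open>v\<close> are obtained by appending a letter at its end.
\<close>

type_synonym word = "bool list"

definition level :: "nat \<Rightarrow> word set" where
  "level n = {w. length w = n}"

definition adjacent :: "word \<Rightarrow> word \<Rightarrow> bool" where
  "adjacent u v \<longleftrightarrow> (\<exists>b. v = u @ [b] \<or> u = v @ [b])"

definition tree_automorphism :: "(word \<Rightarrow> word) \<Rightarrow> bool" where
  "tree_automorphism g \<longleftrightarrow>
     bij g \<and> g [] = [] \<and> (\<forall>u v. adjacent (g u) (g v) \<longleftrightarrow> adjacent u v)"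

text \<open>
  The group generated by \<open>g\<close> is taken inside the group of all permutations of the set of words,
  which contains the tree automorphisms as a subgroup.
\<close>

definition level_transitive :: "(word \<Rightarrow> word) \<Rightarrow> bool" where
  "level_transitive g \<longleftrightarrow>
     (\<forall>n. \<forall>u \<in> level n. \<forall>v \<in> level n. \<exists>h \<in> generate (BijGroup UNIV) {g}. h u = v)"

text \<open>
  \<open>\<int>/2\<^sup>n\<int>\<close> is represented by the residues \<open>{0..<2 ^ n}\<close>.
\<close>

definition residue_map :: "int poly \<Rightarrow> nat \<Rightarrow> int \<Rightarrow> int" where
  "residue_map f n x = poly f x mod 2 ^ n"

definition permutational :: "int poly \<Rightarrow> bool" where
  "permutational f \<longleftrightarrow> (\<forall>n\<ge>1. bij_betw (residue_map f n) {0..<2 ^ n} {0..<2 ^ n})"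

definition word_val :: "word \<Rightarrow> int" where
  "word_val w = (\<Sum>i<length w. of_bool (w ! i) * 2 ^ i)"

text \<open>
  \<open>word_val\<close> identifies \<open>level n\<close> with \<open>{0..<2 ^ n}\<close> (\<open>bij_betw_word_val\<close> below), and the action on
  each level is \<open>residue_map f n\<close> transported along this identification.
\<close>

definition poly_action :: "int poly \<Rightarrow> word \<Rightarrow> word" where
  "poly_action f w =
     inv_into (level (length w)) word_val (residue_map f (length w) (word_val w))"

lemma word_val_horner: "word_val w = horner_sum of_bool 2 w"
  by (simp add: word_val_def horner_sum_eq_sum lessThan_atLeast0)

lemma bij_betw_word_val: "bij_betw word_val (level n) {0..<2 ^ n}"
proof (rule bij_betw_byWitness[where f' = "\<lambda>x. map (bit x) [0..<n]"])
  show "\<forall>w\<in>level n. map (bit (word_val w)) [0..<n] = w"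
    by (auto simp: level_def word_val_horner bit_horner_sum_bit_iff intro!: nth_equalityI)
  show "\<forall>x\<in>{0..<2 ^ n}. word_val (map (bit x) [0..<n]) = x"
    by (auto simp: word_val_horner horner_sum_bit_eq_take_bit take_bit_int_eq_self)
  show "word_val ` level n \<subseteq> {0..<2 ^ n}"
    by (auto simp: word_val_horner level_def horner_sum_nonnegative
        horner_sum_of_bool_2_less)
  show "(\<lambda>x. map (bit x) [0..<n]) ` {0..<2 ^ n} \<subseteq> level n"
    by (auto simp: level_def)
qed

lemma word_val_mod_take: "word_val w mod 2 ^ n = word_val (take n w)"
proof -
  have "take_bit n (word_val w) = word_val (take n w)"
    by (rule bit_eqI) (auto simp: word_val_horner bit_take_bit_iff bit_horner_sum_bit_iff)
  then show ?thesis by (simp add: take_bit_eq_mod)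
qed

lemma residue_map_in: "residue_map f n x \<in> {0..<2 ^ n}"
  by (simp add: residue_map_def)

lemma word_val_poly_action: "word_val (poly_action f w) = residue_map f (length w) (word_val w)"
  using bij_betw_word_val[of "length w"] residue_map_in[of f "length w" "word_val w"]
  unfolding poly_action_def by (metis bij_betw_inv_into_right)

lemma length_poly_action: "length (poly_action f w) = length w"
proof -
  have "poly_action f w \<in> level (length w)"
    unfolding poly_action_def
    by (rule inv_into_into) (metis bij_betw_word_val bij_betw_imp_surj_on residue_map_in)
  then show ?thesis by (simp add: level_def)
qed

lemma word_eqI: "length u = length v \<Longrightarrow> word_val u = word_val v \<Longrightarrow> u = v"
  using bij_betw_word_val[of "length v"] by (auto simp: bij_betw_def inj_on_def level_def)

lemma take_poly_action: "take n (poly_action f w) = poly_action f (take n w)"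
proof (rule word_eqI)
  show "length (take n (poly_action f w)) = length (poly_action f (take n w))"
    by (simp add: length_poly_action)
  let ?m = "min n (length w)"
  have "word_val (take n (poly_action f w)) = word_val (take ?m (poly_action f w))"
    by (metis length_poly_action min.commute take_all_iff min_def nle_le)
  also have "\<dots> = (poly f (word_val w) mod 2 ^ length w) mod 2 ^ ?m"
    by (simp only: word_val_mod_take[symmetric] word_val_poly_action residue_map_def)
  also have "\<dots> = poly f (word_val w) mod 2 ^ ?m"
    by (simp add: mod_mod_cancel le_imp_power_dvd)
  also have "\<dots> = poly f (word_val w mod 2 ^ ?m) mod 2 ^ ?m"
  proof -
    have "[poly f x = poly f (x mod m)] (mod m)" for x m :: int
      by (induction f) (auto intro!: cong_add cong_mult simp: cong_def[of x "x mod m"])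
    then show ?thesis by (simp add: cong_def)
  qed
  also have "\<dots> = word_val (poly_action f (take n w))"
    unfolding word_val_mod_take word_val_poly_action residue_map_def
    by (simp add: min_def)
  finally show "word_val (take n (poly_action f w)) = word_val (poly_action f (take n w))" .
qed

lemma adjacent_iff:
  "adjacent u v \<longleftrightarrow> (length v = Suc (length u) \<and> take (length u) v = u) \<or>
                   (length u = Suc (length v) \<and> take (length v) u = v)"
proof -
  have "(\<exists>b. v = u @ [b]) \<longleftrightarrow> length v = Suc (length u) \<and> take (length u) v = u" for u v :: word
    by (metis append_eq_conv_conj append_take_drop_id length_0_conv length_Suc_conv
        length_append_singleton add_diff_cancel_left' length_drop plus_1_eq_Suc add.commute)
  then show ?thesis unfolding adjacent_def by blast
qed

theorem tree_automorphism_poly_action: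
  assumes "permutational f"
  shows "tree_automorphism (poly_action f)"
proof -
  have bijn: "bij_betw (residue_map f n) {0..<2 ^ n} {0..<2 ^ n}" for n
  proof (cases "n = 0")
    case True
    then show ?thesis by (auto simp: bij_betw_def residue_map_def inj_on_def image_iff)
  qed (use assms in \<open>auto simp: permutational_def\<close>)
  have inj: "inj (poly_action f)"
  proof (rule injI)
    fix u v assume eq: "poly_action f u = poly_action f v"
    then have len: "length u = length v" by (metis length_poly_action)
    have "residue_map f (length v) (word_val u) = residue_map f (length v) (word_val v)"
      using eq len by (metis word_val_poly_action)
    moreover have "word_val u \<in> {0..<2 ^ length v}" "word_val v \<in> {0..<2 ^ length v}"
      using bij_betw_word_val[of "length v"] len by (auto simp: bij_betw_def level_def)
    ultimately have "word_val u = word_val v"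
      using bijn[of "length v"] by (auto simp: bij_betw_def dest: inj_onD)
    with len show "u = v" by (rule word_eqI)
  qed
  have surj: "v \<in> range (poly_action f)" for v
  proof -
    have "finite (level (length v))"
      using bij_betw_finite[OF bij_betw_word_val] by simp
    moreover have "poly_action f ` level (length v) \<subseteq> level (length v)"
      by (auto simp: level_def length_poly_action)
    ultimately have "poly_action f ` level (length v) = level (length v)"
      using inj by (metis endo_inj_surj inj_on_subset subset_UNIV)
    then show ?thesis by (auto simp: level_def)
  qed
  show ?thesis
    unfolding tree_automorphism_def
  proof (intro conjI allI)
    show "bij (poly_action f)" using inj surj by (auto simp: bij_def)
    show "poly_action f [] = []" using length_poly_action[of f "[]"] by simp
    show "adjacent (poly_action f u) (poly_action f v) \<longleftrightarrow> adjacent u v" for u v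
      using inj by (auto simp: adjacent_iff length_poly_action take_poly_action inj_eq)
  qed
qed

end

theory Submission
  imports Defs
begin

text \<open>
  The action is level transitive iff \<open>f\<^bsup>2^n\<^esup>(0) \<equiv> 2\<^sup>n (mod 2\<^bsup>n+1\<^esup>)\<close> for all \<open>n\<close>.
  For \<open>n \<ge> 2\<close> this congruence passes from \<open>n\<close> to \<open>n + 1\<close>: with \<open>h = f\<^bsup>2^n\<^esup>(0)\<close>,
  Taylor expansion gives \<open>f\<^bsup>2^n\<^esup>(h) \<equiv> h + h P (mod h\<^sup>2)\<close>, where \<open>P\<close> is the product of \<open>f'\<close> along the
  orbit of \<open>0\<close>.  Since \<open>f'\<close> is odd and modulo 4 depends only on the parity of its argument,
  \<open>P\<close> is modulo 4 the square of an odd number, so \<open>P \<equiv> 1 (mod 4)\<close>.  What remains are the cases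
  \<open>n \<le> 2\<close>, a computation modulo 8.  There \<open>f\<close> is determined by \<open>a\<^sub>0, a\<^sub>1, a\<^sub>2\<close> (on even arguments) and by
  the sums of its even and of its odd coefficients (on odd arguments).
\<close>

section \<open>Iterates of \<open>f\<close> modulo powers of two\<close>

lemma cong_poly:
  fixes f :: "int poly"
  assumes "[x = y] (mod m)"
  shows "[poly f x = poly f y] (mod m)"
  by (induction f) (auto intro!: cong_add cong_mult assms)

lemma cong_funpow_poly:
  fixes f :: "int poly"
  assumes "[x = y] (mod m)"
  shows "[(poly f ^^ k) x = (poly f ^^ k) y] (mod m)"
  by (induction k) (auto intro: cong_poly assms)

text \<open>Injectivity on the residues \<open>{0..<2 ^ n}\<close> extends to all integers, because
  a value of \<open>f\<close> modulo \<open>2 ^ n\<close> depends only on the argument modulo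
  \<open>2 ^ n\<close>.\<close>

lemma permutational_cong_iff:
  assumes "permutational f"
  shows "[poly f x = poly f y] (mod 2 ^ n) \<longleftrightarrow> [x = y] (mod 2 ^ n)"
proof (cases "n = 0")
  case False
  show ?thesis
  proof
    assume *: "[poly f x = poly f y] (mod 2 ^ n)"
    have "[poly f (x mod 2 ^ n) = poly f x] (mod 2 ^ n)" "[poly f (y mod 2 ^ n) = poly f y] (mod 2 ^ n)"
      by (simp_all add: cong_poly)
    then have "residue_map f n (x mod 2 ^ n) = residue_map f n (y mod 2 ^ n)"
      using * by (simp add: residue_map_def cong_def)
    moreover have "inj_on (residue_map f n) {0..<2 ^ n}"
      using assms False by (auto simp: permutational_def bij_betw_def)
    ultimately show "[x = y] (mod 2 ^ n)"
      by (auto simp: cong_def dest: inj_onD)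
  qed (rule cong_poly)
qed simp

lemma permutational_funpow_cong_iff:
  assumes "permutational f"
  shows "[(poly f ^^ k) x = (poly f ^^ k) y] (mod 2 ^ n) \<longleftrightarrow> [x = y] (mod 2 ^ n)"
  by (induction k) (simp_all add: permutational_cong_iff assms)

lemma word_val_funpow_poly_action:
  "word_val ((poly_action f ^^ k) w) = (poly f ^^ k) (word_val w) mod 2 ^ length w"
proof (induction k)
  case 0
  then show ?case by (metis funpow_0 order_refl take_all_iff word_val_mod_take)
next
  case (Suc k)
  have "length ((poly_action f ^^ k) w) = length w"
    by (induction k) (simp_all add: length_poly_action)
  then show ?case
    using Suc cong_poly[of "(poly f ^^ k) (word_val w) mod 2 ^ length w" _ "2 ^ length w" f]
    by (simp add: word_val_poly_action residue_map_def cong_def)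
qed

lemma funpow_mem_level:
  assumes "w \<in> level n"
  shows "(poly_action f ^^ k) w \<in> level n"
  using assms by (induction k) (simp_all add: level_def length_poly_action)

lemma card_level: "card (level n) = 2 ^ n"
  using bij_betw_same_card[OF bij_betw_word_val[of n]] by simp

section \<open>The generated group and its orbits on a level\<close>

lemma Bij_UNIV_iff: "f \<in> Bij UNIV \<longleftrightarrow> bij f"
  by (simp add: Bij_def)

lemma one_BijGroup_UNIV: "\<one>\<^bsub>BijGroup UNIV\<^esub> = id"
  by (simp add: BijGroup_def restrict_def id_def)

lemma mult_BijGroup_UNIV: "bij f \<Longrightarrow> bij g \<Longrightarrow> f \<otimes>\<^bsub>BijGroup UNIV\<^esub> g = f \<circ> g"
  by (simp add: BijGroup_def Bij_UNIV_iff compose_def restrict_def o_def)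

lemma inv_BijGroup_UNIV: "bij f \<Longrightarrow> inv\<^bsub>BijGroup UNIV\<^esub> f = inv_into UNIV f"
  by (simp add: inv_BijGroup Bij_UNIV_iff restrict_def)

lemma funpow_in_generate:
  assumes "bij g"
  shows "g ^^ k \<in> generate (BijGroup UNIV) {g}"
proof (induction k)
  case 0
  then show ?case by (metis funpow_0 generate.one one_BijGroup_UNIV eq_id_iff)
next
  case (Suc k)
  then have "g \<otimes>\<^bsub>BijGroup UNIV\<^esub> (g ^^ k) \<in> generate (BijGroup UNIV) {g}"
    by (metis generate.eng generate.incl singletonI)
  then show ?case using assms by (simp only: mult_BijGroup_UNIV bij_fn funpow.simps)
qed

text \<open>An injective map of a finite set into itself is onto, so the inverse of \<open>g\<close>
  preserves \<open>A\<close> as well.\<close>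

lemma generate_image_subset:
  assumes "bij g" "finite A" "g ` A \<subseteq> A" "h \<in> generate (BijGroup UNIV) {g}"
  shows "h ` A \<subseteq> A"
proof -
  have gA: "g ` A = A"
    using assms by (meson bij_is_inj endo_inj_surj inj_on_subset subset_UNIV)
  from assms(4) have "bij h \<and> h ` A \<subseteq> A"
  proof (induction rule: generate.induct)
    case one
    then show ?case by (simp add: one_BijGroup_UNIV bij_id[unfolded id_def])
  next
    case (incl h)
    then show ?case using assms(1) gA by simp
  next
    case (inv h)
    have "inv_into UNIV g ` A = A"
      using gA assms(1) by (metis bij_is_inj image_inv_f_f)
    then show ?case
      using inv assms(1) by (simp add: inv_BijGroup_UNIV bij_imp_bij_inv)
  next
    case (eng h1 h2)
    then have "(h1 \<circ> h2) ` A \<subseteq> A" by (simp only: image_comp[symmetric]) blast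
    then show ?case using eng by (simp only: mult_BijGroup_UNIV bij_comp simp_thms)
  qed
  then show ?thesis ..
qed

text \<open>If \<open>u\<close> returns after \<open>k\<close> steps, its first \<open>k\<close>
  iterates are closed under \<open>g\<close>, hence under the generated group. Transitivity makes
  them cover the level, and counting finishes.\<close>

lemma level_transitive_period:
  assumes "level_transitive g" "bij g" "u \<in> level n" "(g ^^ k) u = u" "k > 0"
  shows "2 ^ n \<le> k"
proof -
  define A where "A = (\<lambda>i. (g ^^ i) u) ` {..<k}"
  have "g ` A \<subseteq> A"
  proof safe
    fix v assume "v \<in> A"
    then obtain i where i: "i < k" "v = (g ^^ i) u" by (auto simp: A_def)
    show "g v \<in> A"
    proof (cases "Suc i = k")
      case True
      then have "g v = (g ^^ 0) u" using i assms(4) by auto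
      then show ?thesis using assms(5) unfolding A_def by blast
    next
      case False
      then have "g v = (g ^^ Suc i) u" "Suc i < k" using i by auto
      then show ?thesis unfolding A_def by blast
    qed
  qed
  have "u \<in> A" using assms(5) unfolding A_def by (intro image_eqI[of _ _ 0]) auto
  have "finite A" by (simp add: A_def)
  have "v \<in> A" if v: "v \<in> level n" for v
  proof -
    obtain h where "h \<in> generate (BijGroup UNIV) {g}" "h u = v"
      using assms(1)[unfolded level_transitive_def, rule_format, OF assms(3) v] by (rule bexE)
    then show ?thesis
      using generate_image_subset[OF assms(2) \<open>finite A\<close> \<open>g ` A \<subseteq> A\<close>] \<open>u \<in> A\<close>
      by (metis image_subset_iff)
  qed
  then have "level n \<subseteq> A" ..
  then have "card (level n) \<le> card A" using \<open>finite A\<close> by (rule card_mono[rotated])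
  also have "\<dots> \<le> k" unfolding A_def by (metis card_image_le card_lessThan finite_lessThan)
  finally show ?thesis by (simp add: card_level)
qed

lemma bij_poly_action: "permutational f \<Longrightarrow> bij (poly_action f)"
  using tree_automorphism_poly_action by (simp add: tree_automorphism_def)

lemma word_val_zero: "word_val (replicate n False) = 0"
  by (simp add: word_val_def)

lemma level_transitive_funpow_zero:
  assumes "permutational f" "level_transitive (poly_action f)" "0 < k" "k < 2 ^ n"
  shows "\<not> [(poly f ^^ k) 0 = 0] (mod 2 ^ n)"
proof
  assume *: "[(poly f ^^ k) 0 = 0] (mod 2 ^ n)"
  let ?z = "replicate n False"
  have z: "?z \<in> level n" by (simp add: level_def)
  have "(poly_action f ^^ k) ?z = ?z"
    using funpow_mem_level[OF z, of k f] *
    by (intro word_eqI) (simp_all add: word_val_funpow_poly_action word_val_zero level_def cong_def)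
  then show False
    using level_transitive_period[OF assms(2) bij_poly_action[OF assms(1)] z] assms(3,4)
    by (metis not_le)
qed

text \<open>It suffices to follow the orbit of 0: two words reached from the zero word are joined by
  going back to it and then forward.\<close>

lemma level_transitiveI:
  assumes f: "permutational f"
    and orbit: "\<And>n x. \<exists>k. [(poly f ^^ k) 0 = x] (mod 2 ^ n)"
  shows "level_transitive (poly_action f)"
  unfolding level_transitive_def
proof (intro allI ballI)
  fix n u v assume uv: "u \<in> level n" "v \<in> level n"
  let ?g = "poly_action f" and ?z = "replicate n False" and ?G = "BijGroup (UNIV :: word set)"
  have z: "?z \<in> level n" by (simp add: level_def)
  have reach: "\<exists>k. (?g ^^ k) ?z = w" if w: "w \<in> level n" for w
  proof -
    obtain k where k: "[(poly f ^^ k) 0 = word_val w] (mod 2 ^ n)" using orbit by blast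
    have "word_val w mod 2 ^ n = word_val w"
      using w by (simp add: word_val_mod_take level_def)
    then have "(?g ^^ k) ?z = w"
      using funpow_mem_level[OF z, of k f] k w
      by (intro word_eqI) (simp_all add: word_val_funpow_poly_action word_val_zero level_def cong_def)
    then show ?thesis ..
  qed
  obtain i j where ij: "(?g ^^ i) ?z = u" "(?g ^^ j) ?z = v" using reach uv by metis
  interpret group ?G by (rule group_BijGroup)
  have b: "bij ?g" using f by (rule bij_poly_action)
  then have bk: "bij (?g ^^ m)" for m by (rule bij_fn)
  have "subgroup (generate ?G {?g}) ?G"
    using b by (intro generate_is_subgroup) (simp add: BijGroup_def Bij_UNIV_iff)
  then have mem: "(?g ^^ j) \<otimes>\<^bsub>?G\<^esub> inv\<^bsub>?G\<^esub> (?g ^^ i) \<in> generate ?G {?g}"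
    using funpow_in_generate[OF b] by (simp add: subgroup.m_closed subgroup.m_inv_closed)
  show "\<exists>h\<in>generate ?G {?g}. h u = v"
  proof (rule bexI[OF _ mem])
    have "inv_into UNIV (?g ^^ i) u = ?z"
      using ij(1) bk by (metis bij_is_inj inv_f_f)
    then show "((?g ^^ j) \<otimes>\<^bsub>?G\<^esub> inv\<^bsub>?G\<^esub> (?g ^^ i)) u = v"
      using ij(2) by (simp only: inv_BijGroup_UNIV mult_BijGroup_UNIV bk bij_imp_bij_inv o_apply)
  qed
qed

section \<open>Reaching every residue from 0\<close>

lemma cong_intE:
  fixes x y m :: int
  assumes "[x = y] (mod m)"
  obtains c where "x = y + m * c"
  using cong_sym[OF assms] by (auto simp: cong_iff_lin)

text \<open>A residue modulo \<open>2 ^ n\<close> has exactly two lifts modulo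
  \<open>2 ^ Suc n\<close>, so excluding one determines the other.\<close>

lemma cong_pow2_cases:
  fixes x y :: int
  assumes "[x = y] (mod 2 ^ n)" "\<not> [x = y] (mod 2 ^ Suc n)"
  shows "[x = y + 2 ^ n] (mod 2 ^ Suc n)"
proof -
  obtain c where c: "x - y = 2 ^ n * c" using assms(1) by (auto simp: cong_iff_dvd_diff dvd_def)
  with assms(2) have "odd c" by (auto simp: cong_iff_dvd_diff dvd_def)
  then obtain d where "c = 2 * d + 1" by (auto elim: oddE)
  with c have "x - (y + 2 ^ n) = 2 ^ Suc n * d" by (simp add: algebra_simps)
  then show ?thesis by (simp add: cong_iff_dvd_diff)
qed

text \<open>
  If \<open>f\<^sup>k(0) \<equiv> x\<close> modulo \<open>2\<^sup>n\<close> but not modulo \<open>2\<^bsup>n+1\<^esup>\<close>, then \<open>f\<^bsup>k+2^n\<^esup>(0) \<equiv> x\<close> modulo \<open>2\<^bsup>n+1\<^esup>\<close>.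
\<close>
lemma orbit_zero_all:
  assumes f: "permutational f"
    and exact: "\<And>n. [(poly f ^^ (2 ^ n)) 0 = 2 ^ n] (mod 2 ^ Suc n)"
  shows "\<exists>k. [(poly f ^^ k) 0 = x] (mod 2 ^ n)"
proof (induction n)
  case (Suc n)
  then obtain k where k: "[(poly f ^^ k) 0 = x] (mod 2 ^ n)" by blast
  show ?case
  proof (cases "[(poly f ^^ k) 0 = x] (mod 2 ^ Suc n)")
    case False
    define h where "h = (poly f ^^ (2 ^ n)) 0"
    have h: "[h = 2 ^ n] (mod 2 ^ Suc n)" unfolding h_def by (rule exact)
    have "[h = 0] (mod 2 ^ n)"
      using h cong_dvd_modulus[OF h, of "2 ^ n"] by (simp add: cong_def)
    then have "[(poly f ^^ k) h = x] (mod 2 ^ n)"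
      using k cong_funpow_poly cong_trans by blast
    moreover have "\<not> [(poly f ^^ k) h = (poly f ^^ k) 0] (mod 2 ^ Suc n)"
    proof
      assume "[(poly f ^^ k) h = (poly f ^^ k) 0] (mod 2 ^ Suc n)"
      then have "[2 ^ n = 0] (mod (2 :: int) ^ Suc n)"
        using h unfolding permutational_funpow_cong_iff[OF f] by (metis cong_sym cong_trans)
      then show False by (simp add: cong_def)
    qed
    \<comment> \<open>Both \<open>x\<close> and \<open>(poly f ^^ k) h\<close> lift the residue of
      \<open>(poly f ^^ k) 0\<close> modulo \<open>2 ^ n\<close> and differ from it modulo
      \<open>2 ^ Suc n\<close>, so they are the same other lift.\<close>
    ultimately have "[(poly f ^^ k) h = x] (mod 2 ^ Suc n)"
      using cong_pow2_cases[OF k False] cong_pow2_cases cong_sym cong_trans by metis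
    then show ?thesis unfolding h_def by (metis comp_apply funpow_add)
  qed blast
qed simp

section \<open>Taylor expansion and lifting from one level to the next\<close>

text \<open>Induction along the Horner form \<open>a + x * p\<close> keeps the remainder an integer
  multiple of \<open>h\<^sup>2\<close>, with no division by factorials.\<close>

lemma poly_taylor_cong:
  fixes f :: "int poly"
  shows "[poly f (x + h) = poly f x + h * poly (pderiv f) x] (mod h\<^sup>2)"
proof (induction f)
  case (pCons a p)
  then obtain c where c: "poly p (x + h) = poly p x + h * poly (pderiv p) x + h\<^sup>2 * c"
    using pCons(2) by (elim cong_intE)
  have "poly (pCons a p) (x + h) = poly (pCons a p) x + h * poly (pderiv (pCons a p)) x
      + h\<^sup>2 * (poly (pderiv p) x + (x + h) * c)"
    unfolding poly_pCons c by (simp add: pderiv_pCons algebra_simps power2_eq_square)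
  then show ?case by (simp add: cong_iff_dvd_diff)
qed simp

text \<open>This works because the second derivative of an integer polynomial takes even values.\<close>
lemma poly_pderiv_cong_4:
  fixes f :: "int poly"
  assumes "[x = y] (mod 2)"
  shows "[poly (pderiv f) x = poly (pderiv f) y] (mod 4)"
proof (induction f)
  case (pCons a p)
  obtain k where k: "x = y + 2 * k" using assms by (rule cong_intE)
  obtain c where c: "poly p x = poly p y + 2 * k * poly (pderiv p) y + (2 * k)\<^sup>2 * c"
    using poly_taylor_cong[of p y "2 * k"] unfolding k by (rule cong_intE)
  obtain d where d: "poly (pderiv p) x = poly (pderiv p) y + 4 * d"
    using pCons(2) by (rule cong_intE)
  \<comment> \<open>In the derivative \<open>p + x * p'\<close> of \<open>a + x * p\<close>, both
    summands change by \<open>2 * k * p'(y)\<close> modulo 4, which together vanishes modulo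
    4.\<close>
  have "poly (pderiv (pCons a p)) x = poly (pderiv (pCons a p)) y
      + 4 * (k\<^sup>2 * c + k * poly (pderiv p) y + x * d)"
    using c d by (simp add: pderiv_pCons algebra_simps power2_eq_square k)
  then show ?case by (simp add: cong_iff_dvd_diff)
qed simp

text \<open>By the chain rule the product is the derivative of the \<open>k\<close>-th iterate at
  0.\<close>

lemma funpow_poly_taylor_cong:
  fixes f :: "int poly"
  shows "[(poly f ^^ k) h = (poly f ^^ k) 0 + h * (\<Prod>i<k. poly (pderiv f) ((poly f ^^ i) 0))] (mod h\<^sup>2)"
proof (induction k)
  case (Suc k)
  let ?y = "(poly f ^^ k) 0" and ?P = "\<Prod>i<k. poly (pderiv f) ((poly f ^^ i) 0)"
  have "[poly f ((poly f ^^ k) h) = poly f (?y + h * ?P)] (mod h\<^sup>2)"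
    using Suc by (rule cong_poly)
  also have "[poly f (?y + h * ?P) = poly f ?y + h * ?P * poly (pderiv f) ?y] (mod h\<^sup>2)"
    using poly_taylor_cong[of f ?y "h * ?P"] by (rule cong_dvd_modulus) (simp add: power_mult_distrib)
  finally show ?case by (simp add: mult.assoc)
qed simp

lemma odd_square_cong_4: "odd (x :: int) \<Longrightarrow> [x * x = 1] (mod 4)"
  by (auto elim!: oddE simp: cong_iff_dvd_diff algebra_simps)

text \<open>As the \<open>m\<close>-th iterate of 0 is even, the second half of the orbit repeats
  the parities of the first, so both halves give the same product modulo 4.\<close>

lemma prod_pderiv_orbit_cong:
  fixes f :: "int poly"
  assumes pderiv: "\<And>x. odd (poly (pderiv f) x)"
    and m: "[(poly f ^^ m) 0 = 0] (mod 2)"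
  shows "[(\<Prod>i<2 * m. poly (pderiv f) ((poly f ^^ i) 0)) = 1] (mod 4)"
proof -
  let ?d = "\<lambda>i. poly (pderiv f) ((poly f ^^ i) 0)"
  have "(\<Prod>i<2 * m. ?d i) = (\<Prod>i<m. ?d i) * (\<Prod>i<m. ?d (m + i))"
    using prod.atLeastLessThan_concat[of 0 m "2 * m" ?d] prod.shift_bounds_nat_ivl[of ?d 0 m m]
    by (simp add: lessThan_atLeast0 mult_2 add.commute)
  also have "[\<dots> = (\<Prod>i<m. ?d i) * (\<Prod>i<m. ?d i)] (mod 4)"
  proof (intro cong_mult cong_prod cong_refl poly_pderiv_cong_4)
    fix i
    show "[(poly f ^^ (m + i)) 0 = (poly f ^^ i) 0] (mod 2)"
      using cong_funpow_poly[OF m, of i f] by (simp add: funpow_add add.commute[of m])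
  qed
  also have "[(\<Prod>i<m. ?d i) * (\<Prod>i<m. ?d i) = 1] (mod 4)"
    by (rule odd_square_cong_4) (simp add: pderiv even_prod_iff)
  finally show ?thesis .
qed

text \<open>An even derivative at \<open>x\<close> would identify the values at \<open>x\<close> and
  \<open>x + 2\<close> modulo 4.\<close>

lemma odd_pderiv_permutational:
  assumes "permutational f"
  shows "odd (poly (pderiv f) x)"
proof
  assume "even (poly (pderiv f) x)"
  then have "[poly f x + 2 * poly (pderiv f) x = poly f x] (mod 4)"
    by (auto simp: cong_iff_dvd_diff)
  then have "[poly f (x + 2) = poly f x] (mod 2 ^ 2)"
    using poly_taylor_cong[of f x 2] by (auto intro: cong_trans)
  then show False using permutational_cong_iff[OF assms, of "x + 2" x 2] by (simp add: cong_iff_dvd_diff)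
qed

lemma funpow_zero_lift:
  assumes f: "permutational f" and n: "n \<ge> 2"
    and m: "[(poly f ^^ (2 ^ (n - 1))) 0 = 0] (mod 2)"
    and h: "[(poly f ^^ (2 ^ n)) 0 = 2 ^ n] (mod 2 ^ Suc n)"
  shows "[(poly f ^^ (2 ^ Suc n)) 0 = 2 ^ Suc n] (mod 2 ^ Suc (Suc n))"
proof -
  define H where "H = (poly f ^^ (2 ^ n)) 0"
  define P where "P = (\<Prod>i<2 ^ n. poly (pderiv f) ((poly f ^^ i) 0))"
  have "[P = 1] (mod 4)"
    using prod_pderiv_orbit_cong[OF odd_pderiv_permutational[OF f] m] n
    unfolding P_def by (simp flip: power_Suc)
  then obtain p where p: "P = 1 + 4 * p" by (rule cong_intE)
  obtain c where "H = 2 ^ n + 2 ^ Suc n * c"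
    using h unfolding H_def by (rule cong_intE)
  then have H: "H = 2 ^ n * (1 + 2 * c)" by (simp add: algebra_simps)
  \<comment> \<open>Here \<open>n \<ge> 2\<close> enters: \<open>n + 2 \<le> 2 * n\<close>, so the
    Taylor error is negligible.\<close>
  have "(2 :: int) ^ Suc (Suc n) dvd 2 ^ (2 * n)" using n by (intro le_imp_power_dvd) simp
  moreover have "H\<^sup>2 = 2 ^ (2 * n) * (1 + 2 * c)\<^sup>2"
    by (simp only: H power_mult_distrib power_even_eq)
  ultimately have dvd: "2 ^ Suc (Suc n) dvd H\<^sup>2" by (simp only: dvd_mult2)
  have "(poly f ^^ (2 ^ Suc n)) 0 = (poly f ^^ (2 ^ n)) H"
    unfolding H_def by (simp add: mult_2 funpow_add)
  also have "[\<dots> = H + H * P] (mod 2 ^ Suc (Suc n))"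
    using funpow_poly_taylor_cong[of "2 ^ n" f H] dvd unfolding H_def[symmetric] P_def[symmetric]
    by (rule cong_dvd_modulus)
  \<comment> \<open>This is \<open>2 * H * (1 + 2 * p)\<close>, that is \<open>2 ^ Suc n\<close>
    times the product of the odd numbers \<open>1 + 2 * c\<close> and
    \<open>1 + 2 * p\<close>.\<close>
  also have "H + H * P = 2 ^ Suc n + 2 ^ Suc (Suc n) * (c + p + 2 * c * p)"
    unfolding H p by (simp add: algebra_simps)
  also have "[\<dots> = 2 ^ Suc n] (mod 2 ^ Suc (Suc n))" by (simp add: cong_iff_dvd_diff)
  finally show ?thesis .
qed

lemma funpow_zero_exact:
  assumes f: "permutational f"
    and "[poly f 0 = 1] (mod 2)"
    and 1: "[(poly f ^^ 2) 0 = 2] (mod 4)"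
    and 2: "[(poly f ^^ 4) 0 = 4] (mod 8)"
  shows "[(poly f ^^ (2 ^ n)) 0 = 2 ^ n] (mod 2 ^ Suc n)"
proof -
  \<comment> \<open>Two consecutive levels are carried along because lifting the upper one also uses
    that the iterate at the lower one is even.\<close>
  have lift: "[(poly f ^^ (2 ^ (n + 1))) 0 = 2 ^ (n + 1)] (mod 2 ^ Suc (n + 1)) \<and>
        [(poly f ^^ (2 ^ (n + 2))) 0 = 2 ^ (n + 2)] (mod 2 ^ Suc (n + 2))" for n
  proof (induction n)
    case 0
    show ?case using 1 2 by simp
  next
    case (Suc n)
    have "[(poly f ^^ (2 ^ (n + 1))) 0 = 2 ^ (n + 1)] (mod 2)"
      using Suc.IH by (elim conjE) (erule cong_dvd_modulus, simp)
    then have "[(poly f ^^ (2 ^ (n + 1))) 0 = 0] (mod 2)"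
      by (simp add: cong_def)
    then show ?case
      using funpow_zero_lift[OF f, of "n + 2"] Suc.IH by simp
  qed
  show ?thesis
  proof (cases n)
    case 0
    then show ?thesis using assms(2) by simp
  next
    case (Suc m)
    then show ?thesis using lift[of m] by simp
  qed
qed

section \<open>The computation modulo 8\<close>

text \<open>Terms of degree at least 3 carry the factor \<open>2 ^ 3\<close>.\<close>

lemma poly_even_cong_8:
  fixes f :: "int poly"
  shows "[poly f (2 * y) = coeff f 0 + 2 * coeff f 1 * y + 4 * coeff f 2 * y\<^sup>2] (mod 8)"
proof -
  obtain a b c q where "f = pCons a (pCons b (pCons c q))" by (metis pCons_cases)
  then have "poly f (2 * y) = coeff f 0 + 2 * coeff f 1 * y + 4 * coeff f 2 * y\<^sup>2
      + 8 * (y ^ 3 * poly q (2 * y))"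
    by (simp add: numeral_2_eq_2 algebra_simps power3_eq_cube power2_eq_square)
  then show ?thesis by (simp add: cong_iff_dvd_diff)
qed

lemma odd_square_cong_8:
  assumes "odd (x :: int)"
  shows "[x\<^sup>2 = 1] (mod 8)"
proof -
  obtain k where k: "x = 2 * k + 1" using assms by (auto elim: oddE)
  have "even (k * (k + 1))" by simp
  then obtain l where "k * (k + 1) = 2 * l" by (rule evenE)
  then have "x\<^sup>2 - 1 = 8 * l" by (simp add: k power2_eq_square algebra_simps)
  then show ?thesis by (simp add: cong_iff_dvd_diff)
qed

text \<open>Odd squares are 1 modulo 8, so each power of \<open>x\<close> collapses to 1 or
  \<open>x\<close>.\<close>

lemma poly_odd_cong_8:
  fixes f :: "int poly"
  assumes "odd x"
  shows "[poly f x = (\<Sum>i | even i \<and> i \<le> degree f. coeff f i) +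
      (\<Sum>i | odd i \<and> i \<le> degree f. coeff f i) * x] (mod 8)"
proof -
  have sq: "[x ^ (2 * j) = 1] (mod 8)" for j
    using cong_pow[OF odd_square_cong_8[OF assms], of j] by (simp add: power_mult)
  have pow: "[x ^ i = (if even i then 1 else x)] (mod 8)" for i
    using sq cong_mult[OF cong_refl[of x] sq] by (cases "even i") (auto elim!: evenE oddE)
  have "poly f x = (\<Sum>i\<le>degree f. coeff f i * x ^ i)" by (rule poly_altdef)
  also have "[\<dots> = (\<Sum>i\<le>degree f. coeff f i * (if even i then 1 else x))] (mod 8)"
    by (intro cong_sum cong_mult cong_refl pow)
  also have "(\<Sum>i\<le>degree f. coeff f i * (if even i then 1 else x)) =
      (\<Sum>i\<le>degree f. if even i then coeff f i else 0) + (\<Sum>i\<le>degree f. if odd i then coeff f i else 0) * x"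
    unfolding sum_distrib_right sum.distrib[symmetric] by (intro sum.cong) auto
  also have "(\<Sum>i\<le>degree f. if even i then coeff f i else 0) = (\<Sum>i | even i \<and> i \<le> degree f. coeff f i)"
    by (subst sum.inter_filter[symmetric]) (auto intro!: sum.cong)
  also have "(\<Sum>i\<le>degree f. if odd i then coeff f i else 0) = (\<Sum>i | odd i \<and> i \<le> degree f. coeff f i)"
    by (subst sum.inter_filter[symmetric]) (auto intro!: sum.cong)
  finally show ?thesis .
qed

lemma sum_even_coeff:
  fixes f :: "int poly"
  shows "(\<Sum>i | even i \<and> i \<le> degree f. coeff f i) =
    coeff f 0 + coeff f 2 + (\<Sum>i | even i \<and> 4 \<le> i \<and> i \<le> degree f. coeff f i)"
proof -
  let ?S = "{i. even i \<and> 4 \<le> i \<and> i \<le> degree f}"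
  have "(\<Sum>i | even i \<and> i \<le> degree f. coeff f i) = (\<Sum>i\<in>insert 0 (insert 2 ?S). coeff f i)"
  \<comment> \<open>The index 2 may exceed the degree; its coefficient is then 0.\<close>
  proof (rule sum.mono_neutral_left)
    show "{i. even i \<and> i \<le> degree f} \<subseteq> insert 0 (insert 2 ?S)"
      by (safe; presburger)
  qed (auto intro: le_degree)
  then show ?thesis by simp
qed

lemma sum_odd_coeff:
  fixes f :: "int poly"
  shows "(\<Sum>i | odd i \<and> i \<le> degree f. coeff f i) =
    coeff f 1 + (\<Sum>i | odd i \<and> 3 \<le> i \<and> i \<le> degree f. coeff f i)"
proof -
  let ?S = "{i. odd i \<and> 3 \<le> i \<and> i \<le> degree f}"
  have "(\<Sum>i | odd i \<and> i \<le> degree f. coeff f i) = (\<Sum>i\<in>insert 1 ?S. coeff f i)"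
  proof (rule sum.mono_neutral_left)
    show "{i. odd i \<and> i \<le> degree f} \<subseteq> insert 1 ?S"
      by (safe; presburger)
  qed (auto intro: le_degree)
  then show ?thesis by simp
qed

text \<open>Permutationality makes \<open>coeff f 1\<close> and the two parity sums \<open>E\<close>
  and \<open>O'\<close> odd. Writing them and \<open>coeff f 0\<close> as twice \<open>q\<close>,
  \<open>s\<close>, \<open>r\<close>, \<open>p\<close> plus 1 turns every condition into a parity
  condition.\<close>

lemma orbit_zero_conditions_iff:
  fixes f :: "int poly"
  assumes f: "permutational f" and a0: "odd (coeff f 0)"
  defines "S \<equiv> \<Sum>i | odd i \<and> 3 \<le> i \<and> i \<le> degree f. coeff f i"
    and "T \<equiv> \<Sum>i | even i \<and> 4 \<le> i \<and> i \<le> degree f. coeff f i"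
  shows "[(poly f ^^ 2) 0 = 0] (mod 2)"
    and "[(poly f ^^ 4) 0 = 0] (mod 4)"
    and "[(poly f ^^ 2) 0 = 2] (mod 4) \<and> [(poly f ^^ 4) 0 = 4] (mod 8) \<longleftrightarrow>
      [2 * coeff f 2 = S] (mod 4) \<and> [coeff f 2 + coeff f 1 - 1 = T] (mod 4)"
proof -
  define E where "E = (\<Sum>i | even i \<and> i \<le> degree f. coeff f i)"
  define O' where "O' = (\<Sum>i | odd i \<and> i \<le> degree f. coeff f i)"
  define c where "c = coeff f 2"
  have ev: "[poly f (2 * y) = coeff f 0 + 2 * coeff f 1 * y + 4 * c * y\<^sup>2] (mod 8)" for y
    unfolding c_def by (rule poly_even_cong_8)
  have od: "[poly f x = E + O' * x] (mod 8)" if "odd x" for x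
    unfolding E_def O'_def using that by (rule poly_odd_cong_8)
  \<comment> \<open>Modulo 4 the first two differences are \<open>2 * coeff f 1\<close> and
    \<open>2 * O'\<close>; the third then yields the parity of \<open>E\<close>.\<close>
  have perm: "\<not> 4 dvd poly f 2 - poly f 0" "\<not> 4 dvd poly f 3 - poly f 1"
      "\<not> 2 dvd poly f 1 - poly f 0"
    using permutational_cong_iff[OF f, of 2 0 2] permutational_cong_iff[OF f, of 3 1 2]
      permutational_cong_iff[OF f, of 1 0 1]
    by (simp_all add: cong_iff_dvd_diff)
  have f0: "poly f 0 = coeff f 0" by (simp add: poly_0_coeff_0)
  obtain k where k: "poly f 2 = coeff f 0 + 2 * coeff f 1 + 4 * c + 8 * k"
    using ev[of 1] by (auto elim: cong_intE)
  obtain l where l: "poly f 1 = E + O' + 8 * l"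
    using od[of 1] by (auto elim: cong_intE)
  obtain m where m: "poly f 3 = E + O' * 3 + 8 * m"
    using od[of 3] by (auto elim: cong_intE)
  have "odd (coeff f 1)" using perm(1) unfolding f0 k by presburger
  moreover have "odd O'" using perm(2) unfolding l m by presburger
  moreover from this have "odd E" using perm(3) a0 unfolding f0 l by presburger
  ultimately have "odd (coeff f 1)" "odd O'" "odd E" .
  then obtain p q r s where pqrs: "coeff f 0 = 2 * p + 1" "coeff f 1 = 2 * q + 1"
      "O' = 2 * r + 1" "E = 2 * s + 1"
    using a0 by (metis oddE)
  \<comment> \<open>Half of \<open>E + O' * coeff f 0\<close>, which is the second iterate of 0
    modulo 8.\<close>
  define u where "u = s + 1 + 2 * r * p + r + p"
  have f2: "[(poly f ^^ 2) 0 = 2 * u] (mod 8)"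
    using od[of "coeff f 0"] a0
    by (simp add: numeral_2_eq_2 poly_0_coeff_0 pqrs u_def algebra_simps)
  \<comment> \<open>A quarter of \<open>E + O' * x\<close>, with \<open>x\<close> the third iterate
    of 0 modulo 8; it uses \<open>1 + O' * coeff f 1 = 2 * (1 + 2 * r * q + r + q)\<close>.\<close>
  define w where "w = u * (1 + 2 * r * q + r + q) + O' * c * u\<^sup>2"
  define x where "x = coeff f 0 + 2 * coeff f 1 * u + 4 * c * u\<^sup>2"
  have "[(poly f ^^ 3) 0 = poly f (2 * u)] (mod 8)"
    using cong_poly[OF f2, of f] by (simp add: numeral_3_eq_3 numeral_2_eq_2)
  also have "[poly f (2 * u) = x] (mod 8)" unfolding x_def by (rule ev)
  finally have "[poly f ((poly f ^^ 3) 0) = poly f x] (mod 8)" by (rule cong_poly)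
  also have "[poly f x = E + O' * x] (mod 8)" by (rule od) (simp add: x_def a0)
  \<comment> \<open>With \<open>u\<close> kept folded, \<open>E + O' * coeff f 0\<close> appears
    expanded and cancels against \<open>2 * u\<close> only in the next step.\<close>
  also have "E + O' * x = 4 * w
      + 2 * (s + 1 + 2 * r * p + r + p) - 2 * u"
    unfolding x_def w_def pqrs by (simp add: algebra_simps)
  also have "\<dots> = 4 * w" by (simp add: u_def)
  finally have f4: "[(poly f ^^ 4) 0 = 4 * w] (mod 8)"
    by (simp add: eval_nat_numeral)
  obtain v where v: "(poly f ^^ 2) 0 = 2 * u + 8 * v" using f2 by (rule cong_intE)
  obtain z where z: "(poly f ^^ 4) 0 = 4 * w + 8 * z" using f4 by (rule cong_intE)
  show "[(poly f ^^ 2) 0 = 0] (mod 2)" unfolding v cong_iff_dvd_diff by presburger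
  show "[(poly f ^^ 4) 0 = 0] (mod 4)" unfolding z cong_iff_dvd_diff by presburger
  have A: "[(poly f ^^ 2) 0 = 2] (mod 4) \<longleftrightarrow> odd u"
    unfolding v cong_iff_dvd_diff by presburger
  have B: "[(poly f ^^ 4) 0 = 4] (mod 8) \<longleftrightarrow> odd w"
    unfolding z cong_iff_dvd_diff by presburger
  have S: "S = 2 * (r - q)" and T: "T = 2 * (s - p) - c"
    using sum_odd_coeff[of f] sum_even_coeff[of f] pqrs
    unfolding S_def T_def E_def O'_def c_def by simp_all
  have C: "[2 * coeff f 2 = S] (mod 4) \<longleftrightarrow> even (c + r + q)"
    unfolding S c_def[symmetric] cong_iff_dvd_diff by presburger
  have D: "[coeff f 2 + coeff f 1 - 1 = T] (mod 4) \<longleftrightarrow> even (c + q + s + p)"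
    unfolding T c_def[symmetric] pqrs cong_iff_dvd_diff by presburger
  show "[(poly f ^^ 2) 0 = 2] (mod 4) \<and> [(poly f ^^ 4) 0 = 4] (mod 8) \<longleftrightarrow>
      [2 * coeff f 2 = S] (mod 4) \<and> [coeff f 2 + coeff f 1 - 1 = T] (mod 4)"
    \<comment> \<open>For odd \<open>u\<close>, \<open>w\<close> has the parity of
      \<open>1 + r + q + c\<close>, so \<open>B\<close> matches \<open>C\<close>. Oddness of
      \<open>u\<close> means that \<open>s + r + p\<close> is even; adding the even number
      \<open>c + r + q\<close> turns this into \<open>D\<close>.\<close>
    unfolding A B C D by (auto simp: u_def w_def pqrs)
qed

theorem theorem4p6:
  fixes f :: "int poly"
  assumes "permutational f"
  shows "level_transitive (poly_action f) \<longleftrightarrow>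
    [coeff f 0 = 1] (mod 2) \<and>
    [2 * coeff f 2 = (\<Sum>i | odd i \<and> 3 \<le> i \<and> i \<le> degree f. coeff f i)] (mod 4) \<and>
    [coeff f 2 + coeff f 1 - 1 = (\<Sum>i | even i \<and> 4 \<le> i \<and> i \<le> degree f. coeff f i)] (mod 4)"
    (is "?L \<longleftrightarrow> ?R")
proof
  note cond = orbit_zero_conditions_iff[OF assms]
  have odd_iff: "[x = 1] (mod 2) \<longleftrightarrow> odd x" for x :: int
    by (simp add: cong_def odd_iff_mod_2_eq_one)
  show ?R if ?L
  proof -
    note nz = level_transitive_funpow_zero[OF assms that]
    have a0: "odd (coeff f 0)"
      using nz[of 1 1] by (simp add: poly_0_coeff_0 cong_0_iff)
    \<comment> \<open>Transitivity only rules out a return to 0; evenness leaves 2 as the other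
      candidate modulo 4.\<close>
    have 2: "[(poly f ^^ 2) 0 = 2] (mod 4)"
      using cong_pow2_cases[of "(poly f ^^ 2) 0" 0 1] cond(1)[OF a0] nz[of 2 2] by simp
    have "[(poly f ^^ 4) 0 = 4] (mod 8)"
      using cong_pow2_cases[of "(poly f ^^ 4) 0" 0 2] cond(2)[OF a0] nz[of 4 3] by simp
    with a0 2 show ?R using cond(3)[OF a0] by (simp add: odd_iff)
  qed
  show ?L if ?R
  proof -
    have a0: "odd (coeff f 0)" using that by (simp add: odd_iff)
    then have "[(poly f ^^ 2) 0 = 2] (mod 4)" "[(poly f ^^ 4) 0 = 4] (mod 8)"
      using that cond(3)[OF a0] by blast+
    moreover have "[poly f 0 = 1] (mod 2)" using that by (simp add: poly_0_coeff_0)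
    ultimately show ?L
      by (intro level_transitiveI orbit_zero_all funpow_zero_exact assms)
  qed
qed

end
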